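(* Let $G,G'$ be RDF graphs such that $V_G\cap\mathcal V_{ERDF}=\emptyset$ and $V_{G'}\cap\mathcal V_{ERDF}=\emptyset$, where $V_G$ denotes the set of URI references and literals appearing in $G$. Then $G\models^{RDFS}G'$ (RDFS entailment) if and only if $G\models^{ERDF}G'$ (ERDF entailment).
   Context: **Syntax.** $\mathcal{URI}$, $\mathcal{PL}$, $\mathcal{TL}$ are the sets of URI references, plain literals and typed literals; $\mathcal{LIT}=\mathcal{PL}\cup\mathcal{TL}$; $\mathit{Var}$ is a set of variables; $\mathcal{URI},\mathcal{LIT},\mathit{Var}$ are pairwise disjoint. A typed literal is a pair $``s"\hat{\ }\hat{\ }d$ of a string $s$ and a datatype URI $d$. A vocabulary is a subset of $\mathcal{URI}\cup\mathcal{LIT}$. An RDF triple is an expression $p(s,o)$ with $p\in\mathcal{URI}$, $s\in\mathcal{URI}\cup\mathit{Var}$, $o\in\mathcal{URI}\cup\mathcal{LIT}\cup\mathit{Var}$. An RDF graph is a set of RDF triples; $\mathit{Var}(G)$ is the set of variables appearing in $G$. **Predefined vocabularies** (namespace prefixes rdf:, rdfs:, erdf: omitted; $i$ ranges over $\{1,2,\dots\}$). $\mathcal V_{RDF}$ (rdf:) $=\{\mathtt{type},\mathtt{Property},\mathtt{XMLLiteral},\mathtt{nil},\mathtt{List},\mathtt{Statement},\mathtt{subject},\mathtt{predicate},\mathtt{object},\mathtt{first},\mathtt{rest},\mathtt{Seq},\mathtt{Bag},\mathtt{Alt},\mathtt{value}\}\cup\{\mathtt{\_i}\}_{i}$. $\mathcal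 V_{RDFS}$ (rdfs:) $=\{\mathtt{domain},\mathtt{range},\mathtt{Resource},\mathtt{Literal},\mathtt{Datatype},\mathtt{Class},\mathtt{subClassOf},\mathtt{subPropertyOf},\mathtt{member},\mathtt{Container},\mathtt{ContainerMembershipProperty},\mathtt{comment},\mathtt{seeAlso},\mathtt{isDefinedBy},\mathtt{label}\}$. $\mathcal V_{ERDF}$ (erdf:) $=\{\mathtt{TotalClass},\mathtt{TotalProperty}\}$. **RDF axiomatic triples:** $\mathtt{type}(x,\mathtt{Property})$ for $x\in\{\mathtt{type},\mathtt{subject},\mathtt{predicate},\mathtt{object},\mathtt{first},\mathtt{rest},\mathtt{value},\mathtt{\_i}\}$; $\mathtt{type}(\mathtt{nil},\mathtt{List})$. **RDFS axiomatic triples:** $\mathtt{domain}(x,\mathtt{Resource})$ for $x\in\{\mathtt{type},\mathtt{member},\mathtt{seeAlso},\mathtt{isDefinedBy},\mathtt{comment},\mathtt{label},\mathtt{value},\mathtt{\_i}\}$; $\mathtt{domain}(x,\mathtt{Property})$ for $x\in\{\mathtt{domain},\mathtt{range},\mathtt{subPropertyOf}\}$; $\mathtt{domain}(\mathtt{subClassOf},\mathtt{Class})$; $\mathtt{domain}(x,\mathtt{Statement})$ for $x\in\{\mathtt{subject},\mathtt{predicate},\mathtt{object}\}$; $\mathtt{domain}(x,\mathtt{List})$ for $x\in\{\mathtt{first},\mathtt{rest}\}$; $\mathtt{range}(x,\mathtt{Class})$ for $x\in\{\mathtt{type},\mathtt{domain},\mathtt{range},\mathtt{subClassOf}\}$;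 $\mathtt{range}(\mathtt{subPropertyOf},\mathtt{Property})$; $\mathtt{range}(x,\mathtt{Resource})$ for $x\in\{\mathtt{subject},\mathtt{predicate},\mathtt{object},\mathtt{member},\mathtt{first},\mathtt{seeAlso},\mathtt{isDefinedBy},\mathtt{value},\mathtt{\_i}\}$; $\mathtt{range}(\mathtt{rest},\mathtt{List})$; $\mathtt{range}(x,\mathtt{Literal})$ for $x\in\{\mathtt{comment},\mathtt{label}\}$; $\mathtt{subClassOf}(x,\mathtt{Container})$ for $x\in\{\mathtt{Alt},\mathtt{Bag},\mathtt{Seq}\}$; $\mathtt{subClassOf}(\mathtt{ContainerMembershipProperty},\mathtt{Property})$; $\mathtt{subClassOf}(\mathtt{XMLLiteral},\mathtt{Literal})$; $\mathtt{subClassOf}(\mathtt{Datatype},\mathtt{Class})$; $\mathtt{subPropertyOf}(\mathtt{isDefinedBy},\mathtt{seeAlso})$; $\mathtt{type}(\mathtt{XMLLiteral},\mathtt{Datatype})$; $\mathtt{type}(\mathtt{\_i},\mathtt{ContainerMembershipProperty})$. **ERDF axiomatic triples:** $\mathtt{subClassOf}(\mathtt{TotalClass},\mathtt{Class})$; $\mathtt{subClassOf}(\mathtt{TotalProperty},\mathtt{Property})$. **Simple and partial interpretations.** A simple interpretation $I$ of a vocabulary $V$ consists of a non-empty set $Res_I$; a set $Prop_I$; a map $I_V:V\cap\mathcal{URI}\to Res_I\cup Prop_I$; a map $PT_I:Prop_I\to\mathcal P(Res_I\times Res_I)$; a map $IL_I:V\cap\mathcal{TL}\to Res_I$; a set $LV_I\subseteq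 Res_I$ with $V\cap\mathcal{PL}\subseteq LV_I$. The denotation $I:V\to Res_I\cup Prop_I$ equals $I_V$ on URIs, the identity on plain literals, and $IL_I$ on typed literals. A partial interpretation is a simple interpretation together with a further map $PF_I:Prop_I\to\mathcal P(Res_I\times Res_I)$; it is coherent if $PT_I(x)\cap PF_I(x)=\emptyset$ for all $x\in Prop_I$. For $v:\mathit{Var}(G)\to Res_I$ put $[I+v](x)=v(x)$ for variables and $[I+v](x)=I(x)$ for $x\in V$. $I\models G$ ($G$ an RDF graph, $I$ simple or partial) iff there is $v:\mathit{Var}(G)\to Res_I$ such that for every $p(s,o)\in G$: $p\in V$, $s,o\in V\cup\mathit{Var}$, $I(p)\in Prop_I$ and $\langle[I+v](s),[I+v](o)\rangle\in PT_I(I(p))$. **RDFS interpretation** of $V$: a simple interpretation $I$ of $V\cup\mathcal V_{RDF}\cup\mathcal V_{RDFS}$ (satisfaction is with respect to this vocabulary), with a set $Cls_I\subseteq Res_I$ and a map $CT_I:Cls_I\to\mathcal P(Res_I)$, such that: (R1) $x\in Prop_I$ iff $\langle x,I(\mathtt{Property})\rangle\in PT_I(I(\mathtt{type}))$. (R2) If $l=``s"\hat{\ }\hat{\ }\mathtt{XMLLiteral}\in V$ with $s$ a well-typed XML literal string, then $IL_I(l)$ is the XML value of $s$, $IL_I(l)\in LV_I$, and $\langle IL_I(l),I(\mathtt{XMLLiteral})\rangle\in PT_I(I(\mathtt{type}))$. (R3) If $l=``s"\hat{\ }\hat{\ }\mathtt{XMLLiteral}\in V$ with $s$ ill-typed,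 then $IL_I(l)\in Res_I\setminus LV_I$ and $\langle IL_I(l),I(\mathtt{XMLLiteral})\rangle\notin PT_I(I(\mathtt{type}))$. (R4) $I$ satisfies the RDF and RDFS axiomatic triples. (R5) $x\in CT_I(y)$ iff $\langle x,y\rangle\in PT_I(I(\mathtt{type}))$; $Cls_I=CT_I(I(\mathtt{Class}))$, $Res_I=CT_I(I(\mathtt{Resource}))$, $LV_I=CT_I(I(\mathtt{Literal}))$. (R6) If $\langle x,y\rangle\in PT_I(I(\mathtt{domain}))$ and $\langle z,w\rangle\in PT_I(x)$ then $z\in CT_I(y)$; if $\langle x,y\rangle\in PT_I(I(\mathtt{range}))$ and $\langle z,w\rangle\in PT_I(x)$ then $w\in CT_I(y)$. (R7) $x\in Cls_I$ implies $\langle x,I(\mathtt{Resource})\rangle\in PT_I(I(\mathtt{subClassOf}))$. (R8) $\langle x,y\rangle\in PT_I(I(\mathtt{subClassOf}))$ implies $x,y\in Cls_I$ and $CT_I(x)\subseteq CT_I(y)$; $PT_I(I(\mathtt{subClassOf}))$ is reflexive and transitive on $Cls_I$. (R9) $\langle x,y\rangle\in PT_I(I(\mathtt{subPropertyOf}))$ implies $x,y\in Prop_I$ and $PT_I(x)\subseteq PT_I(y)$; $PT_I(I(\mathtt{subPropertyOf}))$ is reflexive and transitive on $Prop_I$. (R10) $x\in CT_I(I(\mathtt{Datatype}))$ implies $\langle x,I(\mathtt{Literal})\rangle\in PT_I(I(\mathtt{subClassOf}))$; $x\in CT_I(I(\mathtt{ContainerMembershipProperty}))$ implies $\langle x,I(\mathtt{member})\rangle\in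 PT_I(I(\mathtt{subPropertyOf}))$. (XML literal strings and their well-typedness and XML values are as in the W3C RDF Recommendation.) **ERDF interpretation** of $V$: a coherent partial interpretation $I$ of $V'=V\cup\mathcal V_{RDF}\cup\mathcal V_{RDFS}\cup\mathcal V_{ERDF}$ (satisfaction is with respect to $V'$), with sets $Cls_I\subseteq Res_I$, $TCls_I\subseteq Cls_I$, $TProp_I\subseteq Prop_I$ and maps $CT_I,CF_I:Cls_I\to\mathcal P(Res_I)$ such that: (1) $x\in CT_I(y)$ iff $\langle x,y\rangle\in PT_I(I(\mathtt{type}))$, and $x\in CF_I(y)$ iff $\langle x,y\rangle\in PF_I(I(\mathtt{type}))$. (2) $Prop_I$, $Cls_I$, $Res_I$, $LV_I$, $TCls_I$, $TProp_I$ equal $CT_I(I(c))$ for $c=\mathtt{Property},\mathtt{Class},\mathtt{Resource},\mathtt{Literal},\mathtt{TotalClass},\mathtt{TotalProperty}$ respectively. (3) The domain and range conditions (R6). (4) Condition (R7). (5) $\langle x,y\rangle\in PT_I(I(\mathtt{subClassOf}))$ implies $x,y\in Cls_I$, $CT_I(x)\subseteq CT_I(y)$ and $CF_I(y)\subseteq CF_I(x)$; $PT_I(I(\mathtt{subClassOf}))$ is reflexive and transitive on $Cls_I$. (6) $\langle x,y\rangle\in PT_I(I(\mathtt{subPropertyOf}))$ implies $x,y\in Prop_I$, $PT_I(x)\subseteq PT_I(y)$ and $PF_I(y)\subseteq PF_I(x)$; $PT_I(I(\mathtt{subPropertyOf}))$ is reflexive and transitive on $Prop_I$. (7) Condition (R10).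 (8) $x\in TCls_I$ implies $CT_I(x)\cup CF_I(x)=Res_I$; $x\in TProp_I$ implies $PT_I(x)\cup PF_I(x)=Res_I\times Res_I$. (9) If $l=``s"\hat{\ }\hat{\ }\mathtt{XMLLiteral}\in V$ with $s$ well-typed, then $IL_I(l)$ is the XML value of $s$ and $IL_I(l)\in CT_I(I(\mathtt{XMLLiteral}))$; if $s$ is ill-typed, then $IL_I(l)\in Res_I\setminus LV_I$ and $IL_I(l)\in CF_I(I(\mathtt{Literal}))$. (10) $I$ satisfies the RDF, RDFS and ERDF axiomatic triples. **Entailment.** $G\models^{RDFS}G'$ (resp. $G\models^{ERDF}G'$) iff every RDFS (resp. ERDF) interpretation $I$, of any vocabulary, with $I\models G$ satisfies $I\models G'$. *)

theory Defs
  imports Main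
begin

section \<open>Syntax\<close>

text \<open>The predefined URI references are constructors, so they are pairwise distinct; every other
  URI reference is of the form \<open>Uri s\<close>. The name \<open>rdf:_i\<close> is \<open>rdf_n i\<close>; it belongs to the RDF
  vocabulary only for \<open>i \<ge> 1\<close>, and \<open>rdf_n 0\<close> is an ordinary URI reference.\<close>

datatype uri =
    rdf_type | rdf_Property | rdf_XMLLiteral | rdf_nil | rdf_List | rdf_Statement | rdf_subject
  | rdf_predicate | rdf_object | rdf_first | rdf_rest | rdf_Seq | rdf_Bag | rdf_Alt | rdf_value
  | rdf_n nat
  | rdfs_domain | rdfs_range | rdfs_Resource | rdfs_Literal | rdfs_Datatype | rdfs_Class
  | rdfs_subClassOf | rdfs_subPropertyOf | rdfs_member | rdfs_Container
  | rdfs_ContainerMembershipProperty | rdfs_comment | rdfs_seeAlso | rdfs_isDefinedBy | rdfs_label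
  | erdf_TotalClass | erdf_TotalProperty
  | Uri string

text \<open>A plain literal is a string with an optional language tag. Strings are byte sequences, which
  cover Unicode strings through their UTF-8 encoding.\<close>

datatype plain_literal = Plain string "string option"

datatype typed_literal = Typed string uri

datatype name = URI uri | PL plain_literal | TL typed_literal

text \<open>The type parameter \<open>'v\<close> is the set of variables.\<close>

datatype 'v node = Name name | Var 'v

type_synonym 'v triple = "uri \<times> 'v node \<times> 'v node"

text \<open>A vocabulary is a set of names. An RDF graph is a set of triples in which no subject is a
  literal.\<close>

type_synonym vocabulary = "name set"

definition rdf_graph :: "'v triple set \<Rightarrow> bool" where
  "rdf_graph G \<longleftrightarrow> (\<forall>(p, s, o') \<in> G. s \<in> range (Name \<circ> URI) \<union> range Var)"

definition vars :: "'v triple set \<Rightarrow> 'v set" where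
  "vars G = {x. \<exists>(p, s, o') \<in> G. s = Var x \<or> o' = Var x}"

text \<open>The set $V_G$. A typed literal counts as one name: the datatype URI inside it does not by
  itself appear in the graph.\<close>

definition names :: "'v triple set \<Rightarrow> vocabulary" where
  "names G = {n. \<exists>(p, s, o') \<in> G. n = URI p \<or> s = Name n \<or> o' = Name n}"


section \<open>Predefined vocabularies and axiomatic triples\<close>

definition V_RDF :: vocabulary where
  "V_RDF = URI ` ({rdf_type, rdf_Property, rdf_XMLLiteral, rdf_nil, rdf_List, rdf_Statement,
     rdf_subject, rdf_predicate, rdf_object, rdf_first, rdf_rest, rdf_Seq, rdf_Bag, rdf_Alt,
     rdf_value} \<union> rdf_n ` {1..})"

definition V_RDFS :: vocabulary where
  "V_RDFS = URI ` {rdfs_domain, rdfs_range, rdfs_Resource, rdfs_Literal, rdfs_Datatype, rdfs_Class,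
     rdfs_subClassOf, rdfs_subPropertyOf, rdfs_member, rdfs_Container,
     rdfs_ContainerMembershipProperty, rdfs_comment, rdfs_seeAlso, rdfs_isDefinedBy, rdfs_label}"

definition V_ERDF :: vocabulary where
  "V_ERDF = URI ` {erdf_TotalClass, erdf_TotalProperty}"

definition ground_triples :: "uri \<Rightarrow> uri set \<Rightarrow> uri \<Rightarrow> 'v triple set" where
  "ground_triples p S c = {(p, Name (URI x), Name (URI c)) | x. x \<in> S}"

definition RDF_axioms :: "'v triple set" where
  "RDF_axioms =
     ground_triples rdf_type
       ({rdf_type, rdf_subject, rdf_predicate, rdf_object, rdf_first, rdf_rest, rdf_value}
         \<union> rdf_n ` {1..}) rdf_Property
   \<union> ground_triples rdf_type {rdf_nil} rdf_List"

definition RDFS_axioms :: "'v triple set" where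
  "RDFS_axioms =
     ground_triples rdfs_domain
       ({rdf_type, rdfs_member, rdfs_seeAlso, rdfs_isDefinedBy, rdfs_comment, rdfs_label, rdf_value}
         \<union> rdf_n ` {1..}) rdfs_Resource
   \<union> ground_triples rdfs_domain {rdfs_domain, rdfs_range, rdfs_subPropertyOf} rdf_Property
   \<union> ground_triples rdfs_domain {rdfs_subClassOf} rdfs_Class
   \<union> ground_triples rdfs_domain {rdf_subject, rdf_predicate, rdf_object} rdf_Statement
   \<union> ground_triples rdfs_domain {rdf_first, rdf_rest} rdf_List
   \<union> ground_triples rdfs_range {rdf_type, rdfs_domain, rdfs_range, rdfs_subClassOf} rdfs_Class
   \<union> ground_triples rdfs_range {rdfs_subPropertyOf} rdf_Property
   \<union> ground_triples rdfs_range
       ({rdf_subject, rdf_predicate, rdf_object, rdfs_member, rdf_first, rdfs_seeAlso,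
         rdfs_isDefinedBy, rdf_value} \<union> rdf_n ` {1..}) rdfs_Resource
   \<union> ground_triples rdfs_range {rdf_rest} rdf_List
   \<union> ground_triples rdfs_range {rdfs_comment, rdfs_label} rdfs_Literal
   \<union> ground_triples rdfs_subClassOf {rdf_Alt, rdf_Bag, rdf_Seq} rdfs_Container
   \<union> ground_triples rdfs_subClassOf {rdfs_ContainerMembershipProperty} rdf_Property
   \<union> ground_triples rdfs_subClassOf {rdf_XMLLiteral} rdfs_Literal
   \<union> ground_triples rdfs_subClassOf {rdfs_Datatype} rdfs_Class
   \<union> ground_triples rdfs_subPropertyOf {rdfs_isDefinedBy} rdfs_seeAlso
   \<union> ground_triples rdf_type {rdf_XMLLiteral} rdfs_Datatype
   \<union> ground_triples rdf_type (rdf_n ` {1..}) rdfs_ContainerMembershipProperty"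

definition ERDF_axioms :: "'v triple set" where
  "ERDF_axioms =
     ground_triples rdfs_subClassOf {erdf_TotalClass} rdfs_Class
   \<union> ground_triples rdfs_subClassOf {erdf_TotalProperty} rdf_Property"


section \<open>Simple and partial interpretations\<close>

text \<open>The objects an interpretation may talk about: the plain literals, which denote themselves,
  and arbitrary further objects drawn from \<open>'u\<close>.\<close>

datatype 'u object = Plain_Literal plain_literal | Object 'u

record 'u simple_interp =
  Res :: "'u object set"
  Prop :: "'u object set"
  IV :: "uri \<Rightarrow> 'u object"
  PT :: "'u object \<Rightarrow> ('u object \<times> 'u object) set"
  IL :: "typed_literal \<Rightarrow> 'u object"
  LV :: "'u object set"

text \<open>The maps of an interpretation are total functions here. \<open>IV\<close> and \<open>IL\<close> are only consulted on
  the vocabulary. The set-valued maps \<open>PT\<close>, \<open>PF\<close>, and later \<open>CT\<close>, \<open>CF\<close>, are extended by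
  \<open>{}\<close> outside their domain, so that a membership such as \<open>z \<in> CT I y\<close> includes \<open>y \<in> Cls I\<close>.\<close>

locale simple_interpretation =
  fixes V :: vocabulary
    and I :: "('u, 'm) simple_interp_scheme"
  assumes Res_nonempty: "Res I \<noteq> {}"
    and IV_in: "\<And>u. URI u \<in> V \<Longrightarrow> IV I u \<in> Res I \<union> Prop I"
    and PT_in: "\<And>x. x \<in> Prop I \<Longrightarrow> PT I x \<subseteq> Res I \<times> Res I"
    and PT_outside: "\<And>x. x \<notin> Prop I \<Longrightarrow> PT I x = {}"
    and IL_in: "\<And>l. TL l \<in> V \<Longrightarrow> IL I l \<in> Res I"
    and LV_in: "LV I \<subseteq> Res I"
    and plain_in_LV: "\<And>l. PL l \<in> V \<Longrightarrow> Plain_Literal l \<in> LV I"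

locale partial_interpretation = simple_interpretation V I
  for V :: vocabulary and I :: "('u, 'm) simple_interp_scheme" +
  fixes PF :: "'u object \<Rightarrow> ('u object \<times> 'u object) set"
  assumes PF_in: "\<And>x. x \<in> Prop I \<Longrightarrow> PF x \<subseteq> Res I \<times> Res I"
    and PF_outside: "\<And>x. x \<notin> Prop I \<Longrightarrow> PF x = {}"

locale coherent_interpretation = partial_interpretation V I PF
  for V :: vocabulary and I :: "('u, 'm) simple_interp_scheme" and PF +
  assumes coherent: "\<And>x. x \<in> Prop I \<Longrightarrow> PT I x \<inter> PF x = {}"

fun den :: "('u, 'm) simple_interp_scheme \<Rightarrow> name \<Rightarrow> 'u object" where
  "den I (URI u) = IV I u"
| "den I (PL l) = Plain_Literal l"
| "den I (TL l) = IL I l"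

fun den_node :: "('u, 'm) simple_interp_scheme \<Rightarrow> ('v \<Rightarrow> 'u object) \<Rightarrow> 'v node \<Rightarrow> 'u object" where
  "den_node I v (Name n) = den I n"
| "den_node I v (Var x) = v x"

definition satisfies ::
    "vocabulary \<Rightarrow> ('u, 'm) simple_interp_scheme \<Rightarrow> 'v triple set \<Rightarrow> bool" where
  "satisfies V I G \<longleftrightarrow> (\<exists>v. (\<forall>x \<in> vars G. v x \<in> Res I) \<and>
     (\<forall>(p, s, o') \<in> G. URI p \<in> V \<and> s \<in> Name ` V \<union> range Var \<and> o' \<in> Name ` V \<union> range Var \<and>
        den I (URI p) \<in> Prop I \<and> (den_node I v s, den_node I v o') \<in> PT I (den I (URI p))))"


section \<open>RDFS and ERDF interpretations\<close>

text \<open>The parameter \<open>xml\<close> stands for the XML literal strings of the W3C recommendation: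
  \<open>xml s = Some x\<close> means that \<open>s\<close> is a well-typed XML literal string with XML value \<open>x\<close>, and
  \<open>xml s = None\<close> that \<open>s\<close> is ill-typed.

  In the conditions linking \<open>CT\<close> and \<open>CF\<close> to \<open>rdf:type\<close>, the class \<open>y\<close> ranges over \<open>Cls I\<close>, where
  these maps are defined. For \<open>CT\<close> this restriction is immaterial: by the axiomatic triple
  \<open>range(type, Class)\<close>, every \<open>y\<close> with \<open>(x, y)\<close> in the extension of \<open>rdf:type\<close> is in \<open>Cls I\<close>. For
  \<open>CF\<close> it means that \<open>PF I\<close> of \<open>rdf:type\<close> may contain pairs \<open>(x, y)\<close> where \<open>y\<close> is not a class. The
  axiomatic triples contain no variables, so any type of variables can be used to state that they
  hold; it is \<open>unit\<close> below.\<close>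

record 'u rdfs_interp = "'u simple_interp" +
  Cls :: "'u object set"
  CT :: "'u object \<Rightarrow> 'u object set"

locale rdfs_interpretation = simple_interpretation "V \<union> V_RDF \<union> V_RDFS" I
  for V :: vocabulary and I :: "'u rdfs_interp" +
  fixes xml :: "string \<Rightarrow> 'u object option"
  assumes Cls_in: "Cls I \<subseteq> Res I"
    and CT_in: "\<And>y. y \<in> Cls I \<Longrightarrow> CT I y \<subseteq> Res I"
    and CT_outside: "\<And>y. y \<notin> Cls I \<Longrightarrow> CT I y = {}"
    and Prop_iff: "\<And>x. x \<in> Prop I \<longleftrightarrow> (x, IV I rdf_Property) \<in> PT I (IV I rdf_type)"
    and xml_well_typed: "\<And>s x. TL (Typed s rdf_XMLLiteral) \<in> V \<Longrightarrow> xml s = Some x \<Longrightarrow>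
      IL I (Typed s rdf_XMLLiteral) = x \<and> IL I (Typed s rdf_XMLLiteral) \<in> LV I \<and>
      (IL I (Typed s rdf_XMLLiteral), IV I rdf_XMLLiteral) \<in> PT I (IV I rdf_type)"
    and xml_ill_typed: "\<And>s. TL (Typed s rdf_XMLLiteral) \<in> V \<Longrightarrow> xml s = None \<Longrightarrow>
      IL I (Typed s rdf_XMLLiteral) \<in> Res I - LV I \<and>
      (IL I (Typed s rdf_XMLLiteral), IV I rdf_XMLLiteral) \<notin> PT I (IV I rdf_type)"
    and RDF_axioms: "satisfies (V \<union> V_RDF \<union> V_RDFS) I (RDF_axioms :: unit triple set)"
    and RDFS_axioms: "satisfies (V \<union> V_RDF \<union> V_RDFS) I (RDFS_axioms :: unit triple set)"
    and CT_iff: "\<And>x y. y \<in> Cls I \<Longrightarrow> x \<in> CT I y \<longleftrightarrow> (x, y) \<in> PT I (IV I rdf_type)"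
    and Cls_eq: "Cls I = CT I (IV I rdfs_Class)"
    and Res_eq: "Res I = CT I (IV I rdfs_Resource)"
    and LV_eq: "LV I = CT I (IV I rdfs_Literal)"
    and domain: "\<And>x y z w. (x, y) \<in> PT I (IV I rdfs_domain) \<Longrightarrow> (z, w) \<in> PT I x \<Longrightarrow> z \<in> CT I y"
    and range: "\<And>x y z w. (x, y) \<in> PT I (IV I rdfs_range) \<Longrightarrow> (z, w) \<in> PT I x \<Longrightarrow> w \<in> CT I y"
    and subClass_Resource:
      "\<And>x. x \<in> Cls I \<Longrightarrow> (x, IV I rdfs_Resource) \<in> PT I (IV I rdfs_subClassOf)"
    and subClass: "\<And>x y. (x, y) \<in> PT I (IV I rdfs_subClassOf) \<Longrightarrow>
      x \<in> Cls I \<and> y \<in> Cls I \<and> CT I x \<subseteq> CT I y"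
    and subClass_refl: "refl_on (Cls I) (PT I (IV I rdfs_subClassOf))"
    and subClass_trans: "trans_on (Cls I) (PT I (IV I rdfs_subClassOf))"
    and subProperty: "\<And>x y. (x, y) \<in> PT I (IV I rdfs_subPropertyOf) \<Longrightarrow>
      x \<in> Prop I \<and> y \<in> Prop I \<and> PT I x \<subseteq> PT I y"
    and subProperty_refl: "refl_on (Prop I) (PT I (IV I rdfs_subPropertyOf))"
    and subProperty_trans: "trans_on (Prop I) (PT I (IV I rdfs_subPropertyOf))"
    and Datatype: "\<And>x. x \<in> CT I (IV I rdfs_Datatype) \<Longrightarrow>
      (x, IV I rdfs_Literal) \<in> PT I (IV I rdfs_subClassOf)"
    and ContainerMembershipProperty: "\<And>x. x \<in> CT I (IV I rdfs_ContainerMembershipProperty) \<Longrightarrow>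
      (x, IV I rdfs_member) \<in> PT I (IV I rdfs_subPropertyOf)"

record 'u erdf_interp = "'u rdfs_interp" +
  PF :: "'u object \<Rightarrow> ('u object \<times> 'u object) set"
  TCls :: "'u object set"
  TProp :: "'u object set"
  CF :: "'u object \<Rightarrow> 'u object set"

locale erdf_interpretation =
  coherent_interpretation "V \<union> V_RDF \<union> V_RDFS \<union> V_ERDF" I "PF I"
  for V :: vocabulary and I :: "'u erdf_interp" +
  fixes xml :: "string \<Rightarrow> 'u object option"
  assumes Cls_in: "Cls I \<subseteq> Res I"
    and TCls_in: "TCls I \<subseteq> Cls I"
    and TProp_in: "TProp I \<subseteq> Prop I"
    and CT_in: "\<And>y. y \<in> Cls I \<Longrightarrow> CT I y \<subseteq> Res I"
    and CT_outside: "\<And>y. y \<notin> Cls I \<Longrightarrow> CT I y = {}"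
    and CF_in: "\<And>y. y \<in> Cls I \<Longrightarrow> CF I y \<subseteq> Res I"
    and CF_outside: "\<And>y. y \<notin> Cls I \<Longrightarrow> CF I y = {}"
    and CT_iff: "\<And>x y. y \<in> Cls I \<Longrightarrow> x \<in> CT I y \<longleftrightarrow> (x, y) \<in> PT I (IV I rdf_type)"
    and CF_iff: "\<And>x y. y \<in> Cls I \<Longrightarrow> x \<in> CF I y \<longleftrightarrow> (x, y) \<in> PF I (IV I rdf_type)"
    and Prop_eq: "Prop I = CT I (IV I rdf_Property)"
    and Cls_eq: "Cls I = CT I (IV I rdfs_Class)"
    and Res_eq: "Res I = CT I (IV I rdfs_Resource)"
    and LV_eq: "LV I = CT I (IV I rdfs_Literal)"
    and TCls_eq: "TCls I = CT I (IV I erdf_TotalClass)"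
    and TProp_eq: "TProp I = CT I (IV I erdf_TotalProperty)"
    and domain: "\<And>x y z w. (x, y) \<in> PT I (IV I rdfs_domain) \<Longrightarrow> (z, w) \<in> PT I x \<Longrightarrow> z \<in> CT I y"
    and range: "\<And>x y z w. (x, y) \<in> PT I (IV I rdfs_range) \<Longrightarrow> (z, w) \<in> PT I x \<Longrightarrow> w \<in> CT I y"
    and subClass_Resource:
      "\<And>x. x \<in> Cls I \<Longrightarrow> (x, IV I rdfs_Resource) \<in> PT I (IV I rdfs_subClassOf)"
    and subClass: "\<And>x y. (x, y) \<in> PT I (IV I rdfs_subClassOf) \<Longrightarrow>
      x \<in> Cls I \<and> y \<in> Cls I \<and> CT I x \<subseteq> CT I y \<and> CF I y \<subseteq> CF I x"
    and subClass_refl: "refl_on (Cls I) (PT I (IV I rdfs_subClassOf))"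
    and subClass_trans: "trans_on (Cls I) (PT I (IV I rdfs_subClassOf))"
    and subProperty: "\<And>x y. (x, y) \<in> PT I (IV I rdfs_subPropertyOf) \<Longrightarrow>
      x \<in> Prop I \<and> y \<in> Prop I \<and> PT I x \<subseteq> PT I y \<and> PF I y \<subseteq> PF I x"
    and subProperty_refl: "refl_on (Prop I) (PT I (IV I rdfs_subPropertyOf))"
    and subProperty_trans: "trans_on (Prop I) (PT I (IV I rdfs_subPropertyOf))"
    and Datatype: "\<And>x. x \<in> CT I (IV I rdfs_Datatype) \<Longrightarrow>
      (x, IV I rdfs_Literal) \<in> PT I (IV I rdfs_subClassOf)"
    and ContainerMembershipProperty: "\<And>x. x \<in> CT I (IV I rdfs_ContainerMembershipProperty) \<Longrightarrow>
      (x, IV I rdfs_member) \<in> PT I (IV I rdfs_subPropertyOf)"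
    and total_class: "\<And>x. x \<in> TCls I \<Longrightarrow> CT I x \<union> CF I x = Res I"
    and total_property: "\<And>x. x \<in> TProp I \<Longrightarrow> PT I x \<union> PF I x = Res I \<times> Res I"
    and xml_well_typed: "\<And>s x. TL (Typed s rdf_XMLLiteral) \<in> V \<Longrightarrow> xml s = Some x \<Longrightarrow>
      IL I (Typed s rdf_XMLLiteral) = x \<and>
      IL I (Typed s rdf_XMLLiteral) \<in> CT I (IV I rdf_XMLLiteral)"
    and xml_ill_typed: "\<And>s. TL (Typed s rdf_XMLLiteral) \<in> V \<Longrightarrow> xml s = None \<Longrightarrow>
      IL I (Typed s rdf_XMLLiteral) \<in> Res I - LV I \<and>
      IL I (Typed s rdf_XMLLiteral) \<in> CF I (IV I rdfs_Literal)"
    and RDF_axioms: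
      "satisfies (V \<union> V_RDF \<union> V_RDFS \<union> V_ERDF) I (RDF_axioms :: unit triple set)"
    and RDFS_axioms:
      "satisfies (V \<union> V_RDF \<union> V_RDFS \<union> V_ERDF) I (RDFS_axioms :: unit triple set)"
    and ERDF_axioms:
      "satisfies (V \<union> V_RDF \<union> V_RDFS \<union> V_ERDF) I (ERDF_axioms :: unit triple set)"


section \<open>Entailment\<close>

text \<open>The type \<open>'u\<close> of objects from which the interpretations are built is determined by the type
  of \<open>xml\<close>.\<close>

definition rdfs_entails ::
    "(string \<Rightarrow> 'u object option) \<Rightarrow> 'v triple set \<Rightarrow> 'v triple set \<Rightarrow> bool" where
  "rdfs_entails xml G G' \<longleftrightarrow> (\<forall>V (I :: 'u rdfs_interp). rdfs_interpretation V I xml \<longrightarrow>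
     satisfies (V \<union> V_RDF \<union> V_RDFS) I G \<longrightarrow> satisfies (V \<union> V_RDF \<union> V_RDFS) I G')"

definition erdf_entails ::
    "(string \<Rightarrow> 'u object option) \<Rightarrow> 'v triple set \<Rightarrow> 'v triple set \<Rightarrow> bool" where
  "erdf_entails xml G G' \<longleftrightarrow> (\<forall>V (I :: 'u erdf_interp). erdf_interpretation V I xml \<longrightarrow>
     satisfies (V \<union> V_RDF \<union> V_RDFS \<union> V_ERDF) I G \<longrightarrow>
     satisfies (V \<union> V_RDF \<union> V_RDFS \<union> V_ERDF) I G')"

end

theory Submission
  imports Defs
begin

text \<open>An ERDF interpretation is an RDFS interpretation once its negative part is forgotten: an
  ill-typed XML literal is not in the extension of \<open>rdf:XMLLiteral\<close> because that class is contained
  in \<open>rdfs:Literal\<close>. Conversely, an RDFS interpretation becomes an ERDF interpretation on the same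
  resources by reading it classically: all negative extensions are complements, and
  \<open>erdf:TotalClass\<close> and \<open>erdf:TotalProperty\<close> denote the same objects as \<open>rdfs:Class\<close> and
  \<open>rdf:Property\<close>. This redefinition is invisible to graphs that do not mention these two names.\<close>

section \<open>Transfer of satisfaction between interpretations and vocabularies\<close>

text \<open>The same assignment of variables works, since satisfaction depends only on
  \<open>Res\<close>, \<open>Prop\<close>, \<open>PT\<close> and the denotations of the names in
  \<open>G\<close>. Satisfaction over \<open>W\<close> forces \<open>names G\<close> into
  \<open>W\<close>, so the condition on \<open>W'\<close> allows shrinking the vocabulary as well as
  enlarging it.\<close>

lemma satisfies_mono_cong:
  fixes I :: "('u, 'm) simple_interp_scheme" and J :: "('u, 'n) simple_interp_scheme"
  assumes sat: "satisfies W I G"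
    and eqs: "Res J = Res I" "Prop J = Prop I" "PT J = PT I"
    and voc: "names G \<inter> W \<subseteq> W'"
    and den: "\<And>n. n \<in> names G \<Longrightarrow> den J n = den I n"
  shows "satisfies W' J G"
proof -
  obtain v where v: "\<forall>x \<in> vars G. v x \<in> Res I"
    and G: "\<forall>(p, s, o') \<in> G. URI p \<in> W \<and> s \<in> Name ` W \<union> range Var \<and>
      o' \<in> Name ` W \<union> range Var \<and> den I (URI p) \<in> Prop I \<and>
      (den_node I v s, den_node I v o') \<in> PT I (den I (URI p))"
    using sat unfolding satisfies_def by (elim exE conjE)
  have "URI p \<in> W' \<and> s \<in> Name ` W' \<union> range Var \<and> o' \<in> Name ` W' \<union> range Var \<and>
      den J (URI p) \<in> Prop J \<and> (den_node J v s, den_node J v o') \<in> PT J (den J (URI p))"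
    if t: "(p, s, o') \<in> G" for p s o'
  proof -
    note G = G[rule_format, OF t, unfolded prod.case]
    have p: "URI p \<in> names G" using t by (auto simp: names_def)
    have node: "den_node J v a = den_node I v a" "a \<in> Name ` W \<union> range Var \<Longrightarrow> a \<in> Name ` W' \<union> range Var"
      if "a = s \<or> a = o'" for a
    proof -
      have "n \<in> names G" if "a = Name n" for n
        using t \<open>a = s \<or> a = o'\<close> that unfolding names_def by blast
      then show "den_node J v a = den_node I v a"
        "a \<in> Name ` W \<union> range Var \<Longrightarrow> a \<in> Name ` W' \<union> range Var"
        using den voc by (cases a; auto)+
    qed
    have "URI p \<in> W'" using G p voc by blast
    with G den[OF p] node eqs show ?thesis by auto
  qed
  then show ?thesis
    using v eqs unfolding satisfies_def by (intro exI[of _ v]) auto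
qed

lemma satisfies_ground:
  assumes "satisfies W I G" "(p, Name (URI x), Name (URI c)) \<in> G"
  shows "(IV I x, IV I c) \<in> PT I (IV I p)"
  using assms unfolding satisfies_def by fastforce

section \<open>Names in the axiomatic triples\<close>

lemma names_ground_triples: "names (ground_triples p S c) \<subseteq> URI ` insert p (insert c S)"
  by (auto simp: names_def ground_triples_def)

lemma names_Un: "names (A \<union> B) = names A \<union> names B"
  by (auto simp: names_def)

lemma names_RDF_axioms: "names RDF_axioms \<subseteq> V_RDF"
  unfolding RDF_axioms_def names_Un V_RDF_def
  by (intro Un_least; rule subset_trans[OF names_ground_triples]) auto

lemma names_RDFS_axioms: "names RDFS_axioms \<subseteq> V_RDF \<union> V_RDFS"
  unfolding RDFS_axioms_def names_Un V_RDF_def V_RDFS_def image_Un[symmetric]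
  by (intro Un_least; rule subset_trans[OF names_ground_triples], rule image_mono) auto

text \<open>With the two preceding bounds, this shows that the RDF and RDFS axioms survive a
  redefinition of the ERDF names.\<close>

lemma V_ERDF_disjoint: "(V_RDF \<union> V_RDFS) \<inter> V_ERDF = {}"
  by (auto simp: V_RDF_def V_RDFS_def V_ERDF_def)

lemma axiom_triples:
  shows type_type: "(rdf_type, Name (URI rdf_type), Name (URI rdf_Property)) \<in> RDF_axioms"
    and range_type: "(rdfs_range, Name (URI rdf_type), Name (URI rdfs_Class)) \<in> RDFS_axioms"
    and subClass_XMLLiteral:
      "(rdfs_subClassOf, Name (URI rdf_XMLLiteral), Name (URI rdfs_Literal)) \<in> RDFS_axioms"
  by (simp_all add: RDF_axioms_def RDFS_axioms_def ground_triples_def)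

section \<open>Classes in an RDFS interpretation\<close>

context rdfs_interpretation
begin

text \<open>Follows from the axiomatic triple range(type, Class); it removes the side condition of
  \<open>CT_iff\<close>.\<close>

lemma type_Cls: "(x, y) \<in> PT I (IV I rdf_type) \<Longrightarrow> y \<in> Cls I"
  using range[OF satisfies_ground[OF RDFS_axioms range_type]] Cls_eq by auto

lemma CT_type: "x \<in> CT I y \<longleftrightarrow> (x, y) \<in> PT I (IV I rdf_type)"
  using type_Cls CT_iff CT_outside by blast

lemma Prop_eq_CT: "Prop I = CT I (IV I rdf_Property)"
  using Prop_iff CT_type by blast

text \<open>By type(type, Property), \<open>rdf:Property\<close> is a class, so it has type
  \<open>rdfs:Class\<close>; hence \<open>rdfs:Class\<close> is itself the object of a type pair,
  and \<open>type_Cls\<close> applies again.\<close>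

lemma Class_Cls: "IV I rdfs_Class \<in> Cls I"
  using satisfies_ground[OF RDFS_axioms range_type] satisfies_ground[OF RDF_axioms type_type]
    type_Cls Cls_eq CT_type by blast

lemma Property_Cls: "IV I rdf_Property \<in> Cls I"
  using satisfies_ground[OF RDF_axioms type_type] type_Cls by blast

lemma Literal_Cls: "IV I rdfs_Literal \<in> Cls I"
  using satisfies_ground[OF RDFS_axioms subClass_XMLLiteral] subClass by blast

end

section \<open>From ERDF to RDFS: forgetting negation\<close>

definition rdfs_reduct :: "'u erdf_interp \<Rightarrow> 'u rdfs_interp" where
  "rdfs_reduct I = \<lparr>Res = Res I, Prop = Prop I, IV = IV I, PT = PT I, IL = IL I, LV = LV I,
     Cls = Cls I, CT = CT I\<rparr>"

lemma rdfs_reduct_simps [simp]: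
  "Res (rdfs_reduct I) = Res I" "Prop (rdfs_reduct I) = Prop I" "IV (rdfs_reduct I) = IV I"
  "PT (rdfs_reduct I) = PT I" "IL (rdfs_reduct I) = IL I" "LV (rdfs_reduct I) = LV I"
  "Cls (rdfs_reduct I) = Cls I" "CT (rdfs_reduct I) = CT I"
  by (simp_all add: rdfs_reduct_def)

lemma den_rdfs_reduct [simp]: "den (rdfs_reduct I) n = den I n"
  by (cases n) simp_all

lemma satisfies_rdfs_reduct [simp]: "satisfies W (rdfs_reduct I) G \<longleftrightarrow> satisfies W I G"
  by (auto elim: satisfies_mono_cong)

text \<open>RDFS treats the ERDF names as ordinary URI references. Adding them to \<open>V\<close>
  makes the full vocabularies coincide, so satisfaction of a graph is the same on both
  sides.\<close>

lemma rdfs_interpretation_reduct: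
  assumes "erdf_interpretation V I xml"
  shows "rdfs_interpretation (V \<union> V_ERDF) (rdfs_reduct I) xml"
proof -
  interpret erdf_interpretation V I xml by fact
  have type_Cls: "y \<in> Cls I" if "(x, y) \<in> PT I (IV I rdf_type)" for x y
    using range[OF satisfies_ground[OF RDFS_axioms range_type] that] Cls_eq by simp
  have CT_type: "x \<in> CT I y \<longleftrightarrow> (x, y) \<in> PT I (IV I rdf_type)" for x y
    using type_Cls CT_iff CT_outside by blast
  \<comment> \<open>Serves both XML conditions: well-typed literals get into \<open>LV I\<close>,
    and ill-typed ones, being outside \<open>LV I\<close>, stay out of
    \<open>rdf:XMLLiteral\<close>.\<close>
  have XMLLiteral: "CT I (IV I rdf_XMLLiteral) \<subseteq> LV I"
    using satisfies_ground[OF RDFS_axioms subClass_XMLLiteral] subClass LV_eq by blast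
  have voc: "V \<union> V_ERDF \<union> V_RDF \<union> V_RDFS = V \<union> V_RDF \<union> V_RDFS \<union> V_ERDF"
    by blast
  have literals: "TL l \<in> V \<union> V_ERDF \<longleftrightarrow> TL l \<in> V" for l
    by (auto simp: V_ERDF_def)
  show ?thesis
  proof (unfold_locales, unfold voc literals rdfs_reduct_simps satisfies_rdfs_reduct)
    show "x \<in> Prop I \<longleftrightarrow> (x, IV I rdf_Property) \<in> PT I (IV I rdf_type)" for x
      using Prop_eq CT_type by blast
  next
    fix s x
    assume "TL (Typed s rdf_XMLLiteral) \<in> V" "xml s = Some x"
    then show "IL I (Typed s rdf_XMLLiteral) = x \<and> IL I (Typed s rdf_XMLLiteral) \<in> LV I \<and>
      (IL I (Typed s rdf_XMLLiteral), IV I rdf_XMLLiteral) \<in> PT I (IV I rdf_type)"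
      using xml_well_typed XMLLiteral CT_type by blast
  next
    fix s
    assume "TL (Typed s rdf_XMLLiteral) \<in> V" "xml s = None"
    then show "IL I (Typed s rdf_XMLLiteral) \<in> Res I - LV I \<and>
      (IL I (Typed s rdf_XMLLiteral), IV I rdf_XMLLiteral) \<notin> PT I (IV I rdf_type)"
      using xml_ill_typed XMLLiteral CT_type by blast
  next
    show "x \<in> Cls I \<and> y \<in> Cls I \<and> CT I x \<subseteq> CT I y"
      if "(x, y) \<in> PT I (IV I rdfs_subClassOf)" for x y
      using subClass[OF that] by blast
    show "x \<in> Prop I \<and> y \<in> Prop I \<and> PT I x \<subseteq> PT I y"
      if "(x, y) \<in> PT I (IV I rdfs_subPropertyOf)" for x y
      using subProperty[OF that] by blast
  qed (fact Res_nonempty IV_in PT_in PT_outside IL_in LV_in plain_in_LV Cls_in CT_in CT_outside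
    RDF_axioms RDFS_axioms CT_iff Cls_eq Res_eq LV_eq domain range subClass_Resource
    subClass_refl subClass_trans subProperty_refl subProperty_trans Datatype
    ContainerMembershipProperty)+
qed

section \<open>From RDFS to ERDF: classical negation\<close>

text \<open>Complements make coherence and totality automatic, so every class and property can be
  total. The value \<open>{}\<close> off \<open>Prop I\<close> and \<open>Cls I\<close> is the
  convention for partial maps.\<close>

definition classical_expansion :: "'u rdfs_interp \<Rightarrow> 'u erdf_interp" where
  "classical_expansion I = \<lparr>Res = Res I, Prop = Prop I,
     IV = (IV I)(erdf_TotalClass := IV I rdfs_Class, erdf_TotalProperty := IV I rdf_Property),
     PT = PT I, IL = IL I, LV = LV I, Cls = Cls I, CT = CT I,
     PF = (\<lambda>x. if x \<in> Prop I then Res I \<times> Res I - PT I x else {}),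
     TCls = Cls I, TProp = Prop I,
     CF = (\<lambda>x. if x \<in> Cls I then Res I - CT I x else {})\<rparr>"

lemma classical_expansion_simps [simp]:
  "Res (classical_expansion I) = Res I" "Prop (classical_expansion I) = Prop I"
  "IV (classical_expansion I) =
    (IV I)(erdf_TotalClass := IV I rdfs_Class, erdf_TotalProperty := IV I rdf_Property)"
  "PT (classical_expansion I) = PT I" "IL (classical_expansion I) = IL I"
  "LV (classical_expansion I) = LV I" "Cls (classical_expansion I) = Cls I"
  "CT (classical_expansion I) = CT I"
  "PF (classical_expansion I) x = (if x \<in> Prop I then Res I \<times> Res I - PT I x else {})"
  "TCls (classical_expansion I) = Cls I" "TProp (classical_expansion I) = Prop I"
  "CF (classical_expansion I) x = (if x \<in> Cls I then Res I - CT I x else {})"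
  by (simp_all add: classical_expansion_def)

lemma den_classical_expansion: "n \<notin> V_ERDF \<Longrightarrow> den (classical_expansion I) n = den I n"
  by (cases n) (auto simp: V_ERDF_def)

text \<open>Neither the redefined values nor the enlarged vocabulary can affect \<open>G\<close>,
  which contains no ERDF name.\<close>

lemma satisfies_classical_expansion:
  assumes "names G \<inter> V_ERDF = {}"
  shows "satisfies (W \<union> V_ERDF) (classical_expansion I) G \<longleftrightarrow> satisfies W I G"
proof
  have den: "den (classical_expansion I) n = den I n" if "n \<in> names G" for n
    using assms that by (intro den_classical_expansion) blast
  show "satisfies W I G" if "satisfies (W \<union> V_ERDF) (classical_expansion I) G"
    using that by (rule satisfies_mono_cong) (use assms den in auto)
  show "satisfies (W \<union> V_ERDF) (classical_expansion I) G" if "satisfies W I G"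
    using that by (rule satisfies_mono_cong) (use den in auto)
qed

lemma erdf_interpretation_expansion:
  assumes "rdfs_interpretation V I xml"
  shows "erdf_interpretation V (classical_expansion I) xml"
proof -
  interpret rdfs_interpretation V I xml by fact
  \<comment> \<open>\<open>PF\<close> is a complement only at properties; this makes its value at
    \<open>rdf:type\<close> agree with \<open>CF\<close>.\<close>
  have type_Prop: "IV I rdf_type \<in> Prop I"
    using satisfies_ground[OF RDF_axioms type_type] Prop_iff by blast
  have subClassOf_Prop: "IV I rdfs_subClassOf \<in> Prop I"
    using satisfies_ground[OF RDFS_axioms subClass_XMLLiteral] PT_outside by blast
  have voc: "URI rdfs_Class \<in> V_RDFS" "URI rdf_Property \<in> V_RDF"
    "URI rdfs_subClassOf \<in> V_RDFS"
    by (auto simp: V_RDFS_def V_RDF_def)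
  have old_names: "n \<in> V \<union> V_RDF \<union> V_RDFS"
    if "n \<in> V \<union> V_RDF \<union> V_RDFS \<union> V_ERDF" "n \<notin> V_ERDF" for n
    using that by blast
  have literals: "TL l \<notin> V_ERDF" "PL k \<notin> V_ERDF" for l k
    by (auto simp: V_ERDF_def)
  let ?J = "classical_expansion I"
  show ?thesis
  proof
    fix u
    assume u: "URI u \<in> V \<union> V_RDF \<union> V_RDFS \<union> V_ERDF"
    show "IV ?J u \<in> Res ?J \<union> Prop ?J"
    proof (cases "URI u \<in> V_ERDF")
      case True
      then show ?thesis
        using Class_Cls Property_Cls Cls_in by (auto simp: V_ERDF_def)
    next
      case False
      then show ?thesis
        using IV_in[OF old_names[OF u]] Class_Cls Property_Cls Cls_in by auto
    qed
  next
    show "satisfies (V \<union> V_RDF \<union> V_RDFS \<union> V_ERDF) ?J (RDF_axioms :: unit triple set)"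
      using RDF_axioms V_ERDF_disjoint names_RDF_axioms
      by (subst satisfies_classical_expansion) blast+
    show "satisfies (V \<union> V_RDF \<union> V_RDFS \<union> V_ERDF) ?J (RDFS_axioms :: unit triple set)"
      using RDFS_axioms V_ERDF_disjoint names_RDFS_axioms
      by (subst satisfies_classical_expansion) blast+
    show "satisfies (V \<union> V_RDF \<union> V_RDFS \<union> V_ERDF) ?J (ERDF_axioms :: unit triple set)"
      \<comment> \<open>After the redefinition the ERDF axioms say that \<open>rdfs:Class\<close>
        and \<open>rdf:Property\<close> are subclasses of themselves.\<close>
      using refl_onD[OF subClass_refl Class_Cls] refl_onD[OF subClass_refl Property_Cls]
        subClassOf_Prop voc
      by (auto simp: satisfies_def ERDF_axioms_def ground_triples_def vars_def V_ERDF_def)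
  next
    show "TProp ?J = CT ?J (IV ?J erdf_TotalProperty)"
      using Prop_eq_CT by simp
    show "Prop ?J = CT ?J (IV ?J rdf_Property)"
      using Prop_eq_CT by simp
    show "y \<in> Cls ?J \<Longrightarrow> x \<in> CF ?J y \<longleftrightarrow> (x, y) \<in> PF ?J (IV ?J rdf_type)" for x y
      using type_Prop CT_iff Cls_in by auto
    show "x \<in> TCls ?J \<Longrightarrow> CT ?J x \<union> CF ?J x = Res ?J" for x
      using CT_in by auto
    show "x \<in> TProp ?J \<Longrightarrow> PT ?J x \<union> PF ?J x = Res ?J \<times> Res ?J" for x
      using PT_in by auto
    show "IL ?J (Typed s rdf_XMLLiteral) = x \<and>
      IL ?J (Typed s rdf_XMLLiteral) \<in> CT ?J (IV ?J rdf_XMLLiteral)"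
      if "TL (Typed s rdf_XMLLiteral) \<in> V" "xml s = Some x" for s x
      using xml_well_typed[OF that] by (auto simp: CT_type)
    show "TL (Typed s rdf_XMLLiteral) \<in> V \<Longrightarrow> xml s = None \<Longrightarrow>
      IL ?J (Typed s rdf_XMLLiteral) \<in> Res ?J - LV ?J \<and>
      IL ?J (Typed s rdf_XMLLiteral) \<in> CF ?J (IV ?J rdfs_Literal)" for s
      using xml_ill_typed LV_eq Literal_Cls by simp
    show "(x, y) \<in> PT ?J (IV ?J rdfs_subClassOf) \<Longrightarrow>
      x \<in> Cls ?J \<and> y \<in> Cls ?J \<and> CT ?J x \<subseteq> CT ?J y \<and> CF ?J y \<subseteq> CF ?J x" for x y
      \<comment> \<open>Complementation reverses \<open>CT I x \<subseteq> CT I y\<close>; the same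
        happens for \<open>PT\<close> below.\<close>
      using subClass by auto
    show "(x, y) \<in> PT ?J (IV ?J rdfs_subPropertyOf) \<Longrightarrow>
      x \<in> Prop ?J \<and> y \<in> Prop ?J \<and> PT ?J x \<subseteq> PT ?J y \<and> PF ?J y \<subseteq> PF ?J x" for x y
      using subProperty by auto
    show "TL l \<in> V \<union> V_RDF \<union> V_RDFS \<union> V_ERDF \<Longrightarrow> IL ?J l \<in> Res ?J" for l
      using IL_in literals by auto
    show "PL l \<in> V \<union> V_RDF \<union> V_RDFS \<union> V_ERDF \<Longrightarrow> Plain_Literal l \<in> LV ?J" for l
      using plain_in_LV literals by auto
    show "CT ?J y \<subseteq> Res ?J" if "y \<in> Cls ?J" for y
      using that CT_in by simp
    show "PT ?J x \<subseteq> Res ?J \<times> Res ?J" if "x \<in> Prop ?J" for x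
      using that PT_in by simp
    show "z \<in> CT ?J y" if "(x, y) \<in> PT ?J (IV ?J rdfs_domain)" "(z, w) \<in> PT ?J x" for x y z w
      using that domain by simp
    show "w \<in> CT ?J y" if "(x, y) \<in> PT ?J (IV ?J rdfs_range)" "(z, w) \<in> PT ?J x" for x y z w
      using that range by simp
  qed (simp_all add: Res_nonempty PT_outside LV_in Cls_in CT_outside
    CT_iff Res_eq[symmetric] Cls_eq[symmetric] LV_eq[symmetric] subClass_Resource
    subClass_refl subClass_trans subProperty_refl subProperty_trans Datatype
    ContainerMembershipProperty)
qed

theorem proposition3p2:
  fixes G G' :: "'v triple set"
    and xml :: "string \<Rightarrow> 'u object option"
  assumes "rdf_graph G" and "rdf_graph G'"
    and "names G \<inter> V_ERDF = {}" and "names G' \<inter> V_ERDF = {}"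
  shows "rdfs_entails xml G G' \<longleftrightarrow> erdf_entails xml G G'"
proof
  assume rdfs: "rdfs_entails xml G G'"
  have "satisfies (V \<union> V_RDF \<union> V_RDFS \<union> V_ERDF) I G'"
    if "erdf_interpretation V I xml" "satisfies (V \<union> V_RDF \<union> V_RDFS \<union> V_ERDF) I G" for V I
  proof -
    have "V \<union> V_ERDF \<union> V_RDF \<union> V_RDFS = V \<union> V_RDF \<union> V_RDFS \<union> V_ERDF"
      by blast
    then show ?thesis
      using rdfs rdfs_interpretation_reduct[OF that(1)] that(2)
      unfolding rdfs_entails_def by (metis satisfies_rdfs_reduct)
  qed
  then show "erdf_entails xml G G'"
    unfolding erdf_entails_def by blast
next
  assume erdf: "erdf_entails xml G G'"
  show "rdfs_entails xml G G'"
    unfolding rdfs_entails_def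
  proof (intro allI impI)
    fix V I
    assume "rdfs_interpretation V I xml" and "satisfies (V \<union> V_RDF \<union> V_RDFS) I G"
    \<comment> \<open>\<open>G\<close> is carried up to the expansion and \<open>G'\<close> back
      down; both moves rest on disjointness from \<open>V_ERDF\<close>.\<close>
    then show "satisfies (V \<union> V_RDF \<union> V_RDFS) I G'"
      using erdf erdf_interpretation_expansion assms(3,4)
      unfolding erdf_entails_def by (metis satisfies_classical_expansion)
  qed
qed

end
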